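(* Let $(X,\delta)$ be a diversity with tight span $(T_X,\delta_T)$ and canonical embedding $\kappa:X\to T_X$, $\kappa(x)=h_x$, $h_x(A)=\delta(A\cup\{x\})$. If there is an embedding $\pi$ from $(X,\delta)$ into a diversity $(Y,\delta_Y)$ and $(Y,\delta_Y)$ is injective (equivalently, hyperconvex), then there is an embedding $\phi$ from $(T_X,\delta_T)$ into $(Y,\delta_Y)$ such that $\pi=\phi\circ\kappa$.
   Context: For a set $X$, $\mathcal{P}_{\mathrm{fin}}(X)$ denotes the set of all finite subsets of $X$. A diversity is a pair $(X,\delta)$ where $X$ is a set and $\delta:\mathcal{P}_{\mathrm{fin}}(X)\to\mathbb{R}$ satisfies, for all finite $A,B,C\subseteq X$: (D1) $\delta(A)\ge 0$, and $\delta(A)=0$ if and only if $|A|\le 1$; (D2) if $B\ne\emptyset$ then $\delta(A\cup C)\le\delta(A\cup B)+\delta(B\cup C)$. Given diversities $(Y_1,\delta_1)$ and $(Y_2,\delta_2)$, a map $\phi:Y_1\to Y_2$ is non-expansive if $\delta_1(A)\ge\delta_2(\phi(A))$ for all finite $A\subseteq Y_1$, and it is an embedding if it is injective (one-to-one) and $\delta_1(A)=\delta_2(\phi(A))$ for all finite $A\subseteq Y_1$. A diversity $(X,\delta)$ is injective if: given any pair of diversities $(Y_1,\delta_1)$, $(Y_2,\delta_2)$, an embedding $\pi:Y_1\to Y_2$ and a non-expansive map $\phi:Y_1\to X$, there is a non-expansive map $\psi:Y_2\to X$ such that $\phi=\psi\circ\pi$. A diversity $(X,\delta)$ is hyperconvex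 if for all $r:\mathcal{P}_{\mathrm{fin}}(X)\to\mathbb{R}$ such that $\delta\big(\bigcup_{A\in\mathscr{A}}A\big)\le\sum_{A\in\mathscr{A}}r(A)$ for all finite $\mathscr{A}\subseteq\mathcal{P}_{\mathrm{fin}}(X)$, there is $z\in X$ such that $\delta(\{z\}\cup Y)\le r(Y)$ for all finite $Y\subseteq X$. A diversity is injective if and only if it is hyperconvex. Given a diversity $(X,\delta)$, $P_X$ is the set of all functions $f:\mathcal{P}_{\mathrm{fin}}(X)\to\mathbb{R}$ with $f(\emptyset)=0$ and $\sum_{A\in\mathscr{A}}f(A)\ge\delta\big(\bigcup_{A\in\mathscr{A}}A\big)$ for all finite $\mathscr{A}\subseteq\mathcal{P}_{\mathrm{fin}}(X)$. Write $f\preceq g$ if $f(A)\le g(A)$ for all finite $A\subseteq X$. The tight span $T_X$ is the set of elements of $P_X$ that are minimal with respect to $\preceq$. The function $\delta_T:\mathcal{P}_{\mathrm{fin}}(T_X)\to\mathbb{R}$ is defined by $\delta_T(\emptyset)=0$ and, for finite non-empty $F\subseteq T_X$, $$\delta_T(F)=\sup\left\{\delta\Big(\bigcup_{A\in\mathscr{A}}A\Big)-\sum_{A\in\mathscr{A}}\inf_{f\in F}f(A):\ \mathscr{A}\subseteq\mathcal{P}_{\mathrm{fin}}(X),\ |\mathscr{A}|<\infty\right\}.$$ The pair $(T_X,\delta_T)$ is a diversity, and $\kappa$ takes values in $T_X$. *)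

theory Defs
  imports Complex_Main "HOL-Library.FuncSet"
begin

text \<open>
  The finite subsets of \<open>X\<close> form the library set \<open>Fpow X\<close>. A diversity is given by a carrier
  \<open>X\<close> and a total function \<open>\<delta>\<close>, of which only the values on \<open>Fpow X\<close> matter.
\<close>

locale diversity =
  fixes X :: "'a set" and \<delta> :: "'a set \<Rightarrow> real"
  assumes nonneg: "A \<in> Fpow X \<Longrightarrow> 0 \<le> \<delta> A"
    and zero_iff: "A \<in> Fpow X \<Longrightarrow> \<delta> A = 0 \<longleftrightarrow> card A \<le> 1"
    and triangle: "\<lbrakk>A \<in> Fpow X; B \<in> Fpow X; C \<in> Fpow X; B \<noteq> {}\<rbrakk>
                    \<Longrightarrow> \<delta> (A \<union> C) \<le> \<delta> (A \<union> B) + \<delta> (B \<union> C)"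

definition nonexpansive ::
  "'a set \<Rightarrow> ('a set \<Rightarrow> real) \<Rightarrow> 'b set \<Rightarrow> ('b set \<Rightarrow> real) \<Rightarrow> ('a \<Rightarrow> 'b) \<Rightarrow> bool" where
  "nonexpansive Y1 \<delta>1 Y2 \<delta>2 \<phi> \<longleftrightarrow>
     \<phi> \<in> Y1 \<rightarrow> Y2 \<and> (\<forall>A\<in>Fpow Y1. \<delta>1 A \<ge> \<delta>2 (\<phi> ` A))"

definition diversity_embedding ::
  "'a set \<Rightarrow> ('a set \<Rightarrow> real) \<Rightarrow> 'b set \<Rightarrow> ('b set \<Rightarrow> real) \<Rightarrow> ('a \<Rightarrow> 'b) \<Rightarrow> bool" where
  "diversity_embedding Y1 \<delta>1 Y2 \<delta>2 \<phi> \<longleftrightarrow>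
     \<phi> \<in> Y1 \<rightarrow> Y2 \<and> inj_on \<phi> Y1 \<and> (\<forall>A\<in>Fpow Y1. \<delta>1 A = \<delta>2 (\<phi> ` A))"

text \<open>
  Injectivity quantifies over all diversities \<open>Y1\<close> and \<open>Y2\<close>. A HOL formula cannot quantify over
  types, so the types of their points are explicit parameters: the predicate tests all
  diversities \<open>Y1\<close> with points in \<open>'b\<close> and \<open>Y2\<close> with points in \<open>'c\<close>. Used as a hypothesis, an
  instance of it is weaker than injectivity with respect to all diversities.
\<close>

definition injective_diversity ::
  "'b itself \<Rightarrow> 'c itself \<Rightarrow> 'a set \<Rightarrow> ('a set \<Rightarrow> real) \<Rightarrow> bool" where
  "injective_diversity _ _ X \<delta> \<longleftrightarrow>
     (\<forall>(Y1 :: 'b set) \<delta>1 (Y2 :: 'c set) \<delta>2 \<pi> \<phi>.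
        diversity Y1 \<delta>1 \<longrightarrow> diversity Y2 \<delta>2 \<longrightarrow>
        diversity_embedding Y1 \<delta>1 Y2 \<delta>2 \<pi> \<longrightarrow> nonexpansive Y1 \<delta>1 X \<delta> \<phi> \<longrightarrow>
        (\<exists>\<psi>. nonexpansive Y2 \<delta>2 X \<delta> \<psi> \<and> (\<forall>y\<in>Y1. \<phi> y = (\<psi> \<circ> \<pi>) y)))"

definition hyperconvex_diversity :: "'a set \<Rightarrow> ('a set \<Rightarrow> real) \<Rightarrow> bool" where
  "hyperconvex_diversity X \<delta> \<longleftrightarrow>
     (\<forall>r :: 'a set \<Rightarrow> real.
        (\<forall>\<A>. finite \<A> \<and> \<A> \<subseteq> Fpow X \<longrightarrow> \<delta> (\<Union>\<A>) \<le> (\<Sum>A\<in>\<A>. r A)) \<longrightarrow>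
        (\<exists>z\<in>X. \<forall>Y\<in>Fpow X. \<delta> ({z} \<union> Y) \<le> r Y))"

text \<open>
  Functions with domain \<open>Fpow X\<close> are total functions that are \<open>undefined\<close> outside \<open>Fpow X\<close>
  (\<open>extensional\<close>), so that equality in the tight span is equality on \<open>Fpow X\<close>.
\<close>

definition diversity_P :: "'a set \<Rightarrow> ('a set \<Rightarrow> real) \<Rightarrow> ('a set \<Rightarrow> real) set" where
  "diversity_P X \<delta> =
     {f \<in> extensional (Fpow X). f {} = 0 \<and>
        (\<forall>\<A>. finite \<A> \<and> \<A> \<subseteq> Fpow X \<longrightarrow> (\<Sum>A\<in>\<A>. f A) \<ge> \<delta> (\<Union>\<A>))}"

definition tight_span :: "'a set \<Rightarrow> ('a set \<Rightarrow> real) \<Rightarrow> ('a set \<Rightarrow> real) set" where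
  "tight_span X \<delta> =
     {f \<in> diversity_P X \<delta>.
        \<forall>g\<in>diversity_P X \<delta>. (\<forall>A\<in>Fpow X. g A \<le> f A) \<longrightarrow> g = f}"

text \<open>
  For \<open>F\<close> a finite non-empty subset of the tight span, the set of reals under \<open>SUP\<close> is non-empty
  and bounded above and the one under \<open>INF\<close> is finite and non-empty.
\<close>

definition tight_span_diversity ::
  "'a set \<Rightarrow> ('a set \<Rightarrow> real) \<Rightarrow> ('a set \<Rightarrow> real) set \<Rightarrow> real" where
  "tight_span_diversity X \<delta> F =
     (if F = {} then 0
      else SUP \<A>\<in>{\<A>. \<A> \<subseteq> Fpow X \<and> finite \<A>}.
             \<delta> (\<Union>\<A>) - (\<Sum>A\<in>\<A>. INF f\<in>F. f A))"

definition tight_span_kappa :: "'a set \<Rightarrow> ('a set \<Rightarrow> real) \<Rightarrow> 'a \<Rightarrow> 'a set \<Rightarrow> real" where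
  "tight_span_kappa X \<delta> x = (\<lambda>A\<in>Fpow X. \<delta> (A \<union> {x}))"

end

theory Submission
  imports Defs
begin

text \<open>
  Write \<open>T\<close> for the tight span and \<open>\<kappa>\<close> for its canonical embedding.

  Injectivity of \<open>Y\<close>, applied to \<open>\<kappa>\<close> and \<open>\<pi>\<close>, gives a non-expansive \<open>\<psi>\<close> on \<open>T\<close> with
  \<open>\<pi> = \<psi> \<circ> \<kappa>\<close>. The point is that \<open>T\<close> leaves no room to contract: every non-expansive \<open>\<psi>\<close> of this
  kind is an embedding (\<open>nonexpansive_extension_is_embedding\<close>). Indeed, the diversity of a finite
  \<open>F \<subseteq> T\<close> is the supremum, over sets \<open>A f\<close> chosen for the members \<open>f\<close> of \<open>F\<close>, of
  \<open>\<delta> (\<Union>f\<in>F. A f) - (\<Sum>f\<in>F. f (A f))\<close> (\<open>tight_span_regroup\<close>), and the set \<open>\<kappa> ` A \<union> {f}\<close> has diversity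
  at most \<open>f A\<close> (\<open>tight_span_diversity_insert_kappa_le\<close>). In \<open>Y\<close>, attaching to \<open>\<psi> ` F\<close> the images
  of the sets \<open>\<kappa> ` A f \<union> {f}\<close> produces a superset of \<open>\<pi> ` (\<Union>f\<in>F. A f)\<close>, which has diversity
  \<open>\<delta> (\<Union>f\<in>F. A f)\<close>. So \<open>\<delta>Y (\<psi> ` F)\<close> is at least each term of the supremum.

  To use injectivity one has to know that \<open>T\<close> is a diversity (\<open>tight_span_is_diversity\<close>) and that
  \<open>\<kappa>\<close> is an embedding (\<open>kappa_embedding\<close>). The separation of points and the triangle inequality
  in \<open>T\<close> come from minimality in the form \<open>f A = (SUP C. \<delta> (A \<union> C) - f C)\<close>
  (\<open>tight_span_approx\<close>). That the supremum is finite and that \<open>\<kappa>\<close> preserves diversity come from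
  subadditivity along overlapping sets (\<open>star_bound\<close>).

  If \<open>Y\<close> is given as hyperconvex, it is injective (\<open>hyperconvex_imp_injective\<close>): hyperconvexity
  extends a partial non-expansive map to one more point, and Zorn's lemma extends it to all points.
\<close>

section \<open>Finite families in a diversity\<close>

context diversity
begin

lemma empty [simp]: "\<delta> {} = 0"
  using zero_iff[of "{}"] by (simp add: Fpow_def)

lemma singleton [simp]: "x \<in> X \<Longrightarrow> \<delta> {x} = 0"
  using zero_iff[of "{x}"] by (simp add: Fpow_def)

lemma eq_of_pair_zero:
  assumes "x \<in> X" "y \<in> X" "\<delta> {x, y} \<le> 0"
  shows "x = y"
proof (rule ccontr)
  assume "x \<noteq> y"
  then have "card {x, y} = 2" by simp
  moreover have "{x, y} \<in> Fpow X" using assms by (simp add: Fpow_def)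
  ultimately show False using nonneg[of "{x, y}"] zero_iff[of "{x, y}"] assms(3) by simp
qed

lemma mono:
  assumes "A \<subseteq> B" and "B \<in> Fpow X"
  shows "\<delta> A \<le> \<delta> B"
proof -
  have "\<delta> A \<le> \<delta> (A \<union> D)" if "finite D" "D \<subseteq> X" for D
    using that
  proof (induction D)
    case empty
    then show ?case by simp
  next
    case (insert d D)
    have "A \<union> D \<in> Fpow X" "{d} \<in> Fpow X" "{} \<in> Fpow X"
      using insert.prems insert.hyps assms by (auto simp: Fpow_def intro: finite_subset)
    from triangle[OF this(1,2,3)] have "\<delta> (A \<union> D) \<le> \<delta> (A \<union> D \<union> {d})"
      using insert.prems by simp
    then show ?case using insert by simp
  qed
  from this[of B] show ?thesis using assms by (simp add: Fpow_def sup.absorb2)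
qed

lemma union_overlap:
  assumes "A \<in> Fpow X" "B \<in> Fpow X" "A \<inter> B \<noteq> {}"
  shows "\<delta> (A \<union> B) \<le> \<delta> A + \<delta> B"
  using triangle[of A "A \<inter> B" B] assms
  by (auto simp: Fpow_def Int_commute sup.absorb1 sup.absorb2 Un_Int_eq)

text \<open>
  The sets \<open>B i\<close> are attached to a common base \<open>A\<close> one after another, and each step costs
  \<open>\<delta> (B i)\<close> because \<open>\<delta>\<close> is subadditive on overlapping sets.
\<close>

lemma star_bound:
  assumes "finite I" and A: "A \<in> Fpow X"
    and "\<And>i. i \<in> I \<Longrightarrow> B i \<in> Fpow X" and "\<And>i. i \<in> I \<Longrightarrow> B i \<inter> A \<noteq> {}"
  shows "\<delta> (A \<union> (\<Union>i\<in>I. B i)) \<le> \<delta> A + (\<Sum>i\<in>I. \<delta> (B i))"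
  using assms(1,3,4)
proof (induction I)
  case empty
  then show ?case by simp
next
  case (insert j I)
  have "\<delta> ((A \<union> (\<Union>i\<in>I. B i)) \<union> B j) \<le> \<delta> (A \<union> (\<Union>i\<in>I. B i)) + \<delta> (B j)"
    using insert.hyps insert.prems(1) insert.prems(2)[of j] A
    by (intro union_overlap) (auto simp: Fpow_def)
  also have "\<dots> \<le> \<delta> A + (\<Sum>i\<in>I. \<delta> (B i)) + \<delta> (B j)"
    using insert by simp
  finally show ?case using insert.hyps by (simp add: Un_ac)
qed


section \<open>Elements of the tight span\<close>

lemma P_ge:
  assumes "f \<in> diversity_P X \<delta>" "A \<in> Fpow X"
  shows "\<delta> A \<le> f A"
proof -
  have "\<delta> (\<Union>{A}) \<le> (\<Sum>A\<in>{A}. f A)"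
    using assms unfolding diversity_P_def by blast
  then show ?thesis by simp
qed

lemma P_nonneg: "f \<in> diversity_P X \<delta> \<Longrightarrow> A \<in> Fpow X \<Longrightarrow> 0 \<le> f A"
  using P_ge nonneg by (meson order_trans)

lemma P_insert:
  assumes f: "f \<in> diversity_P X \<delta>" and A: "A \<in> Fpow X"
    and \<B>: "finite \<B>" "\<B> \<subseteq> Fpow X"
  shows "\<delta> (A \<union> \<Union>\<B>) \<le> f A + sum f \<B>"
proof -
  have "\<delta> (\<Union>(insert A \<B>)) \<le> sum f (insert A \<B>)"
    using assms unfolding diversity_P_def by blast
  also have "\<dots> \<le> f A + sum f \<B>"
    using P_nonneg[OF f A] \<B> by (simp add: sum.insert_if)
  finally show ?thesis by simp
qed

lemma P_union:
  assumes "f \<in> diversity_P X \<delta>" "A \<in> Fpow X" "B \<in> Fpow X"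
  shows "\<delta> (A \<union> B) \<le> f A + f B"
  using P_insert[of f A "{B}"] assms by simp

lemma tight_span_P: "f \<in> tight_span X \<delta> \<Longrightarrow> f \<in> diversity_P X \<delta>"
  by (simp add: tight_span_def)

lemma tight_span_minimal:
  assumes "f \<in> tight_span X \<delta>" "g \<in> diversity_P X \<delta>" "\<And>A. A \<in> Fpow X \<Longrightarrow> g A \<le> f A"
  shows "g = f"
  using assms by (auto simp: tight_span_def)

text \<open>
  If the constraints that involve \<open>A\<close> all had slack at least \<open>e\<close>, then the value at \<open>A\<close> could be
  lowered by \<open>e\<close>, against minimality.
\<close>

lemma tight_span_approx_family:
  assumes f: "f \<in> tight_span X \<delta>" and A: "A \<in> Fpow X" and e: "e > 0"
  shows "\<exists>\<B>. finite \<B> \<and> \<B> \<subseteq> Fpow X \<and> f A + sum f \<B> < \<delta> (A \<union> \<Union>\<B>) + e"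
proof (rule ccontr)
  assume contra: "\<not> ?thesis"
  have slack: "\<delta> (A \<union> \<Union>\<B>) + e \<le> f A + sum f \<B>"
    if "finite \<B>" "\<B> \<subseteq> Fpow X" for \<B>
  proof (rule leI, rule notI)
    assume "f A + sum f \<B> < \<delta> (A \<union> \<Union>\<B>) + e"
    then show False using contra that by blast
  qed
  have P: "f \<in> diversity_P X \<delta>" by (rule tight_span_P[OF f])
  \<comment> \<open>The value at \<open>{}\<close> is prescribed, so \<open>A = {}\<close> has to be excluded: there the empty family is
    a constraint without slack.\<close>
  have "f {} = 0" using P by (simp add: diversity_P_def)
  then have "A \<noteq> {}" using slack[of "{}"] e by auto
  have "f(A := f A - e) \<in> diversity_P X \<delta>"
    unfolding diversity_P_def
  proof (intro CollectI conjI allI impI)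
    show "f(A := f A - e) \<in> extensional (Fpow X)"
      using P A by (auto simp: diversity_P_def extensional_def)
    show "(f(A := f A - e)) {} = 0"
      using \<open>A \<noteq> {}\<close> P by (simp add: diversity_P_def)
    fix \<A> assume \<A>: "finite \<A> \<and> \<A> \<subseteq> Fpow X"
    show "\<delta> (\<Union>\<A>) \<le> sum (f(A := f A - e)) \<A>"
    proof (cases "A \<in> \<A>")
      case True
      have "sum (f(A := f A - e)) \<A> = f A - e + sum (f(A := f A - e)) (\<A> - {A})"
        using \<A> True by (subst sum.remove[of \<A> A]) auto
      also have "sum (f(A := f A - e)) (\<A> - {A}) = sum f (\<A> - {A})"
        by (intro sum.cong) auto
      finally have "sum (f(A := f A - e)) \<A> = f A - e + sum f (\<A> - {A})" .
      moreover have "A \<union> \<Union>(\<A> - {A}) = \<Union>\<A>" using True by auto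
      moreover have "\<delta> (A \<union> \<Union>(\<A> - {A})) + e \<le> f A + sum f (\<A> - {A})"
        using \<A> by (intro slack) auto
      ultimately show ?thesis by simp
    next
      case False
      then have "sum (f(A := f A - e)) \<A> = sum f \<A>"
        by (intro sum.cong) auto
      then show ?thesis using P \<A> by (simp add: diversity_P_def)
    qed
  qed
  then have "f(A := f A - e) = f"
    using e by (intro tight_span_minimal[OF f]) auto
  then have "f A - e = f A" by (metis fun_upd_same)
  then show False using e by simp
qed

lemma tight_span_union:
  assumes f: "f \<in> tight_span X \<delta>" and A: "A \<in> Fpow X" and B: "B \<in> Fpow X"
  shows "f (A \<union> B) \<le> f A + f B"
proof (rule field_le_epsilon)
  fix e :: real assume "e > 0"
  have P: "f \<in> diversity_P X \<delta>" by (rule tight_span_P[OF f])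
  have "A \<union> B \<in> Fpow X" using A B by (auto simp: Fpow_def)
  from tight_span_approx_family[OF f this \<open>e > 0\<close>] obtain \<B>
    where \<B>: "finite \<B>" "\<B> \<subseteq> Fpow X" "f (A \<union> B) + sum f \<B> < \<delta> (A \<union> B \<union> \<Union>\<B>) + e"
    by blast
  have "\<delta> (A \<union> \<Union>(insert B \<B>)) \<le> f A + sum f (insert B \<B>)"
    using P A B \<B> by (intro P_insert) auto
  moreover have "sum f (insert B \<B>) \<le> f B + sum f \<B>"
    using P_nonneg[OF P B] \<B> by (simp add: sum.insert_if)
  ultimately show "f (A \<union> B) \<le> f A + f B + e"
    using \<B>(3) by (simp add: Un_ac)
qed

lemma tight_span_Union:
  assumes f: "f \<in> tight_span X \<delta>" and "finite \<B>" "\<B> \<subseteq> Fpow X"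
  shows "f (\<Union>\<B>) \<le> sum f \<B>"
  using assms(2,3)
proof (induction \<B>)
  case empty
  then show ?case using tight_span_P[OF f] by (simp add: diversity_P_def)
next
  case (insert B \<B>)
  have "f (B \<union> \<Union>\<B>) \<le> f B + f (\<Union>\<B>)"
    using insert by (intro tight_span_union[OF f]) (auto simp: Fpow_def)
  then show ?case using insert by simp
qed

text \<open>
  By subadditivity of \<open>f\<close>, one set \<open>C\<close> does what the whole family did above. In other words,
  \<open>f A\<close> is the supremum of \<open>\<delta> (A \<union> C) - f C\<close>.
\<close>

lemma tight_span_approx:
  assumes f: "f \<in> tight_span X \<delta>" and A: "A \<in> Fpow X" and e: "e > 0"
  obtains C where "C \<in> Fpow X" "f A + f C < \<delta> (A \<union> C) + e"
proof -
  obtain \<B> where \<B>: "finite \<B>" "\<B> \<subseteq> Fpow X" "f A + sum f \<B> < \<delta> (A \<union> \<Union>\<B>) + e"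
    using tight_span_approx_family[OF assms] by blast
  have "\<Union>\<B> \<in> Fpow X" using \<B> by (auto simp: Fpow_def)
  moreover have "f A + f (\<Union>\<B>) < \<delta> (A \<union> \<Union>\<B>) + e"
    using tight_span_Union[OF f \<B>(1,2)] \<B>(3) by linarith
  ultimately show ?thesis using that by blast
qed


section \<open>The tight span is a diversity\<close>

text \<open>
  Send each member of \<open>\<A>\<close> to an \<open>f \<in> F\<close> that attains the infimum there. Merging the members with
  the same \<open>f\<close> does not raise the cost, because \<open>f\<close> is subadditive. So the supremum that defines
  the diversity of \<open>F\<close> may be taken over families indexed by \<open>F\<close> itself.
\<close>

lemma tight_span_regroup:
  assumes F: "finite F" "F \<noteq> {}" "F \<subseteq> tight_span X \<delta>" and \<A>: "finite \<A>" "\<A> \<subseteq> Fpow X"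
  obtains A where "A \<in> F \<rightarrow> Fpow X" "(\<Union>f\<in>F. A f) = \<Union>\<A>"
    "(\<Sum>f\<in>F. f (A f)) \<le> (\<Sum>B\<in>\<A>. INF f\<in>F. f B)"
proof -
  have "\<exists>m\<in>F. m B = (INF f\<in>F. f B)" for B
  proof -
    have "(INF f\<in>F. f B) = Min ((\<lambda>f. f B) ` F)"
      using F by (intro cInf_eq_Min) auto
    also have "\<dots> \<in> (\<lambda>f. f B) ` F"
      using F by (intro Min_in) auto
    finally show ?thesis by auto
  qed
  then obtain m where m: "\<And>B. m B \<in> F" "\<And>B. m B B = (INF f\<in>F. f B)"
    by metis
  define A where "A f = \<Union>{B\<in>\<A>. m B = f}" for f
  have "A \<in> F \<rightarrow> Fpow X"
  proof
    fix f
    have "finite (A f)" unfolding A_def using \<A> by (intro finite_Union) (auto simp: Fpow_def)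
    then show "A f \<in> Fpow X" using \<A> by (auto simp: A_def Fpow_def)
  qed
  moreover have "(\<Union>f\<in>F. A f) = \<Union>\<A>" using m(1) by (auto simp: A_def)
  moreover have "(\<Sum>f\<in>F. f (A f)) \<le> (\<Sum>B\<in>\<A>. INF f\<in>F. f B)"
  proof -
    have "(\<Sum>f\<in>F. f (A f)) \<le> (\<Sum>f\<in>F. \<Sum>B\<in>{B\<in>\<A>. m B = f}. f B)"
      unfolding A_def using F \<A> by (intro sum_mono tight_span_Union) auto
    also have "\<dots> = (\<Sum>f\<in>F. \<Sum>B\<in>{B\<in>\<A>. m B = f}. m B B)"
      by (intro sum.cong) auto
    also have "\<dots> = (\<Sum>B\<in>\<A>. m B B)"
      using F \<A> m(1) by (intro sum.group) auto
    finally show ?thesis by (simp add: m(2))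
  qed
  ultimately show ?thesis using that by blast
qed

lemma tight_span_diversity_leI:
  assumes F: "finite F" "F \<noteq> {}" "F \<subseteq> tight_span X \<delta>"
    and le: "\<And>A. A \<in> F \<rightarrow> Fpow X \<Longrightarrow> \<delta> (\<Union>f\<in>F. A f) \<le> c + (\<Sum>f\<in>F. f (A f))"
  shows "tight_span_diversity X \<delta> F \<le> c"
proof -
  have "(SUP \<A>\<in>{\<A>. \<A> \<subseteq> Fpow X \<and> finite \<A>}. \<delta> (\<Union>\<A>) - (\<Sum>A\<in>\<A>. INF f\<in>F. f A)) \<le> c"
  proof (rule cSUP_least)
    fix \<A> assume "\<A> \<in> {\<A>. \<A> \<subseteq> Fpow X \<and> finite \<A>}"
    then obtain A where "A \<in> F \<rightarrow> Fpow X" "(\<Union>f\<in>F. A f) = \<Union>\<A>"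
      "(\<Sum>f\<in>F. f (A f)) \<le> (\<Sum>B\<in>\<A>. INF f\<in>F. f B)"
      using tight_span_regroup[OF F] by blast
    then show "\<delta> (\<Union>\<A>) - (\<Sum>A\<in>\<A>. INF f\<in>F. f A) \<le> c"
      using le[of A] by simp
  qed auto
  then show ?thesis using F by (simp add: tight_span_diversity_def)
qed

text \<open>
  A fixed point \<open>x\<close> of \<open>X\<close> serves as a common base: joining it to every \<open>A f\<close> costs at most
  \<open>f {x}\<close> each.
\<close>

lemma tight_span_diversity_bdd:
  assumes F: "finite F" "F \<noteq> {}" "F \<subseteq> tight_span X \<delta>"
  shows "bdd_above ((\<lambda>\<A>. \<delta> (\<Union>\<A>) - (\<Sum>A\<in>\<A>. INF f\<in>F. f A)) ` {\<A>. \<A> \<subseteq> Fpow X \<and> finite \<A>})"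
proof -
  have "\<exists>c. \<forall>A\<in>F \<rightarrow> Fpow X. \<delta> (\<Union>f\<in>F. A f) \<le> c + (\<Sum>f\<in>F. f (A f))"
  proof (cases "X = {}")
    case True
    have "\<delta> (\<Union>f\<in>F. A f) \<le> 0 + (\<Sum>f\<in>F. f (A f))" if "A \<in> F \<rightarrow> Fpow X" for A
    proof -
      have "A f = {}" if "f \<in> F" for f using \<open>A \<in> F \<rightarrow> Fpow X\<close> that True by (auto simp: Fpow_def)
      moreover have "0 \<le> (\<Sum>f\<in>F. f (A f))"
        using F that by (intro sum_nonneg P_nonneg tight_span_P) auto
      ultimately show ?thesis by simp
    qed
    then show ?thesis by blast
  next
    case False
    then obtain x where x: "x \<in> X" by blast
    have "\<delta> (\<Union>f\<in>F. A f) \<le> (\<Sum>f\<in>F. f {x}) + (\<Sum>f\<in>F. f (A f))" if A: "A \<in> F \<rightarrow> Fpow X" for A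
    proof -
      have "\<delta> (\<Union>f\<in>F. A f) \<le> \<delta> ({x} \<union> (\<Union>f\<in>F. {x} \<union> A f))"
        using A F x by (intro mono) (auto simp: Fpow_def)
      also have "\<dots> \<le> \<delta> {x} + (\<Sum>f\<in>F. \<delta> ({x} \<union> A f))"
        using A F x by (intro star_bound) (auto simp: Fpow_def)
      also have "\<dots> \<le> \<delta> {x} + (\<Sum>f\<in>F. f {x} + f (A f))"
        using A F x
        by (intro add_left_mono sum_mono P_union tight_span_P) (auto simp: Fpow_def)
      finally show ?thesis using x by (simp add: sum.distrib)
    qed
    then show ?thesis by blast
  qed
  then obtain c
    where c: "\<And>A. A \<in> F \<rightarrow> Fpow X \<Longrightarrow> \<delta> (\<Union>f\<in>F. A f) \<le> c + (\<Sum>f\<in>F. f (A f))"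
    by blast
  show ?thesis
  proof (rule bdd_aboveI2[where M = c])
    fix \<A> assume "\<A> \<in> {\<A>. \<A> \<subseteq> Fpow X \<and> finite \<A>}"
    then obtain A where "A \<in> F \<rightarrow> Fpow X" "(\<Union>f\<in>F. A f) = \<Union>\<A>"
      "(\<Sum>f\<in>F. f (A f)) \<le> (\<Sum>B\<in>\<A>. INF f\<in>F. f B)"
      using tight_span_regroup[OF F] by blast
    then show "\<delta> (\<Union>\<A>) - (\<Sum>A\<in>\<A>. INF f\<in>F. f A) \<le> c"
      using c[of A] by simp
  qed
qed

lemma tight_span_diversity_ge:
  assumes F: "finite F" "F \<subseteq> tight_span X \<delta>"
    and I: "finite I" "I \<noteq> {}"
    and A: "\<And>i. i \<in> I \<Longrightarrow> A i \<in> Fpow X" and p: "\<And>i. i \<in> I \<Longrightarrow> p i \<in> F"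
  shows "\<delta> (\<Union>i\<in>I. A i) \<le> tight_span_diversity X \<delta> F + (\<Sum>i\<in>I. p i (A i))"
proof -
  have "F \<noteq> {}" using I p by blast
  have "(\<Sum>B\<in>A ` I. INF f\<in>F. f B) \<le> (\<Sum>i\<in>I. INF f\<in>F. f (A i))"
  proof -
    have "0 \<le> (INF f\<in>F. f (A i))" if "i \<in> I" for i
      using F A that \<open>F \<noteq> {}\<close> by (intro cINF_greatest P_nonneg tight_span_P) auto
    from sum_image_le[of I "\<lambda>B. INF f\<in>F. f B" A, OF I(1) this] show ?thesis
      by (simp add: o_def)
  qed
  also have "\<dots> \<le> (\<Sum>i\<in>I. p i (A i))"
    using F p by (intro sum_mono cINF_lower bdd_below_finite) auto
  finally have "(\<Sum>B\<in>A ` I. INF f\<in>F. f B) \<le> (\<Sum>i\<in>I. p i (A i))" .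
  moreover have "\<delta> (\<Union>(A ` I)) - (\<Sum>B\<in>A ` I. INF f\<in>F. f B) \<le> tight_span_diversity X \<delta> F"
    unfolding tight_span_diversity_def using F \<open>F \<noteq> {}\<close> I A
    by (auto intro!: cSUP_upper[OF _ tight_span_diversity_bdd])
  ultimately show ?thesis by simp
qed

lemma tight_span_diversity_ge_insert:
  assumes F: "finite F" "F \<subseteq> tight_span X \<delta>"
    and J: "J \<subseteq> F" and A: "\<And>f. f \<in> J \<Longrightarrow> A f \<in> Fpow X" and g: "g \<in> F" "B \<in> Fpow X"
  shows "\<delta> ((\<Union>f\<in>J. A f) \<union> B) \<le> tight_span_diversity X \<delta> F + (\<Sum>f\<in>J. f (A f)) + g B"
proof -
  have J': "finite J" using F J finite_subset by blast
  \<comment> \<open>The extra index \<open>None\<close> keeps the pair \<open>(g, B)\<close> apart from the family, as \<open>g\<close> may lie in \<open>J\<close>.\<close>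
  let ?I = "insert None (Some ` J)"
  let ?A = "case_option B A" and ?p = "case_option g id"
  have "\<delta> (\<Union>i\<in>?I. ?A i) \<le> tight_span_diversity X \<delta> F + (\<Sum>i\<in>?I. ?p i (?A i))"
    using J' J A g by (intro tight_span_diversity_ge[OF F]) auto
  moreover have "(\<Sum>i\<in>?I. ?p i (?A i)) = g B + (\<Sum>f\<in>J. f (A f))"
    using J' by (subst sum.insert) (auto simp: sum.reindex)
  moreover have "(\<Union>i\<in>?I. ?A i) = (\<Union>f\<in>J. A f) \<union> B" by auto
  ultimately show ?thesis by simp
qed

lemma tight_span_diversity_nonneg:
  assumes "finite F" "F \<subseteq> tight_span X \<delta>"
  shows "0 \<le> tight_span_diversity X \<delta> F"
proof (cases "F = {}")
  case False
  then obtain f where "f \<in> F" by blast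
  moreover from this have "f {} = 0"
    using assms tight_span_P by (auto simp: diversity_P_def)
  ultimately show ?thesis
    using tight_span_diversity_ge[OF assms, of "{f}" "\<lambda>_. {}" id] by (simp add: Fpow_def)
qed (simp add: tight_span_diversity_def)

text \<open>
  If two members \<open>f\<close> and \<open>g\<close> of \<open>F\<close> are at diversity \<open>0\<close>, then \<open>\<delta> (A \<union> C) - f C\<close> is at most
  \<open>g A\<close> for all \<open>C\<close>. The supremum over \<open>C\<close> is \<open>f A\<close>, so \<open>f\<close> lies below \<open>g\<close>, and minimality
  of \<open>g\<close> makes them equal.
\<close>

lemma tight_span_eq_of_diversity_zero:
  assumes F: "finite F" "F \<subseteq> tight_span X \<delta>" "tight_span_diversity X \<delta> F \<le> 0"
    and f: "f \<in> F" and g: "g \<in> F"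
  shows "f = g"
proof (rule tight_span_minimal)
  show "g \<in> tight_span X \<delta>" using F g by blast
  have fT: "f \<in> tight_span X \<delta>" using F f by blast
  then show "f \<in> diversity_P X \<delta>" by (rule tight_span_P)
  fix A assume A: "A \<in> Fpow X"
  show "f A \<le> g A"
  proof (rule field_le_epsilon)
    fix e :: real assume "e > 0"
    then obtain C where C: "C \<in> Fpow X" "f A + f C < \<delta> (A \<union> C) + e"
      using tight_span_approx[OF fT A] by blast
    have "\<delta> (C \<union> A) \<le> tight_span_diversity X \<delta> F + f C + g A"
      using tight_span_diversity_ge_insert[OF F(1,2), of "{f}" "\<lambda>_. C" g A] A C f g by simp
    then show "f A \<le> g A + e" using C F(3) by (simp add: Un_commute)
  qed
qed

lemma tight_span_diversity_singleton:
  assumes f: "f \<in> tight_span X \<delta>"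
  shows "tight_span_diversity X \<delta> {f} = 0"
proof (rule antisym)
  show "tight_span_diversity X \<delta> {f} \<le> 0"
    using f P_ge[OF tight_span_P[OF f]] by (intro tight_span_diversity_leI) auto
  show "0 \<le> tight_span_diversity X \<delta> {f}"
    using f by (intro tight_span_diversity_nonneg) auto
qed

text \<open>
  Let \<open>a\<close> and \<open>b\<close> be the unions of the sets chosen for \<open>F\<close> and for \<open>H - F\<close>. A point \<open>g\<close> of the
  middle set \<open>G\<close> receives \<open>b\<close> in the estimate for \<open>F \<union> G\<close>, and in the estimate for \<open>G \<union> H\<close> a
  set \<open>D\<close> for which \<open>\<delta> (b \<union> D)\<close> nearly equals \<open>g b + g D\<close>. The values of \<open>g\<close> then cancel.
\<close>

lemma tight_span_diversity_triangle:
  assumes F: "F \<in> Fpow (tight_span X \<delta>)" and G: "G \<in> Fpow (tight_span X \<delta>)"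
    and H: "H \<in> Fpow (tight_span X \<delta>)" and "G \<noteq> {}"
  shows "tight_span_diversity X \<delta> (F \<union> H)
    \<le> tight_span_diversity X \<delta> (F \<union> G) + tight_span_diversity X \<delta> (G \<union> H)"
proof (cases "F \<union> H = {}")
  case True
  then show ?thesis
    using tight_span_diversity_nonneg[of G] G by (simp add: tight_span_diversity_def Fpow_def)
next
  case False
  obtain g where g: "g \<in> G" using \<open>G \<noteq> {}\<close> by blast
  have gT: "g \<in> tight_span X \<delta>" using g G by (auto simp: Fpow_def)
  have fin: "finite F" "finite G" "finite H"
    and sub: "F \<subseteq> tight_span X \<delta>" "G \<subseteq> tight_span X \<delta>" "H \<subseteq> tight_span X \<delta>"
    using F G H by (auto simp: Fpow_def)
  show ?thesis
  proof (rule tight_span_diversity_leI)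
    fix A assume A: "A \<in> F \<union> H \<rightarrow> Fpow X"
    define a b where "a = (\<Union>f\<in>F. A f)" and "b = (\<Union>f\<in>H - F. A f)"
    have b: "b \<in> Fpow X" using A fin by (auto simp: b_def Fpow_def)
    have AX: "A f \<in> Fpow X" if "f \<in> F \<union> H" for f using A that by blast
    have "\<delta> (a \<union> b) \<le> tight_span_diversity X \<delta> (F \<union> G) + tight_span_diversity X \<delta> (G \<union> H)
        + (\<Sum>f\<in>F \<union> H. f (A f))"
    proof (rule field_le_epsilon)
      fix e :: real assume "e > 0"
      then obtain D where D: "D \<in> Fpow X" "g b + g D < \<delta> (b \<union> D) + e"
        using tight_span_approx[OF gT b] by blast
      have "\<delta> (a \<union> b) \<le> tight_span_diversity X \<delta> (F \<union> G) + (\<Sum>f\<in>F. f (A f)) + g b"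
        unfolding a_def using fin sub AX g b
        by (intro tight_span_diversity_ge_insert) auto
      moreover have "\<delta> (b \<union> D)
          \<le> tight_span_diversity X \<delta> (G \<union> H) + (\<Sum>f\<in>H - F. f (A f)) + g D"
        unfolding b_def using fin sub AX g D
        by (intro tight_span_diversity_ge_insert) auto
      moreover have "(\<Sum>f\<in>F \<union> H. f (A f)) = (\<Sum>f\<in>F. f (A f)) + (\<Sum>f\<in>H - F. f (A f))"
        using fin by (subst sum.union_disjoint[symmetric]) auto
      ultimately show "\<delta> (a \<union> b) \<le> tight_span_diversity X \<delta> (F \<union> G)
          + tight_span_diversity X \<delta> (G \<union> H) + (\<Sum>f\<in>F \<union> H. f (A f)) + e"
        using D(2) by linarith
    qed
    moreover have "a \<union> b = (\<Union>f\<in>F \<union> H. A f)" by (auto simp: a_def b_def)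
    ultimately show "\<delta> (\<Union>f\<in>F \<union> H. A f) \<le> tight_span_diversity X \<delta> (F \<union> G)
        + tight_span_diversity X \<delta> (G \<union> H) + (\<Sum>f\<in>F \<union> H. f (A f))"
      by simp
  qed (use fin sub False in auto)
qed

lemma tight_span_is_diversity: "diversity (tight_span X \<delta>) (tight_span_diversity X \<delta>)"
proof
  fix F assume F: "F \<in> Fpow (tight_span X \<delta>)"
  then have fin: "finite F" and sub: "F \<subseteq> tight_span X \<delta>" by (auto simp: Fpow_def)
  show "0 \<le> tight_span_diversity X \<delta> F"
    by (rule tight_span_diversity_nonneg[OF fin sub])
  show "tight_span_diversity X \<delta> F = 0 \<longleftrightarrow> card F \<le> 1"
  proof
    assume "tight_span_diversity X \<delta> F = 0"
    then have "f = g" if "f \<in> F" "g \<in> F" for f g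
      using that by (intro tight_span_eq_of_diversity_zero[OF fin sub]) auto
    then show "card F \<le> 1" using fin by (simp add: card_le_Suc0_iff_eq)
  next
    assume "card F \<le> 1"
    then consider "F = {}" | f where "F = {f}"
      using fin by (metis One_nat_def card_0_eq card_1_singletonE le_SucE le_zero_eq)
    then show "tight_span_diversity X \<delta> F = 0"
      using sub
      by cases (simp add: tight_span_diversity_def, simp add: tight_span_diversity_singleton)
  qed
qed (rule tight_span_diversity_triangle)


section \<open>The canonical embedding\<close>

lemma kappa_apply: "A \<in> Fpow X \<Longrightarrow> tight_span_kappa X \<delta> x A = \<delta> (A \<union> {x})"
  by (simp add: tight_span_kappa_def)

text \<open>
  Membership in \<open>diversity_P\<close> is the star bound with base \<open>{x}\<close>. For minimality, a competitor
  \<open>g\<close> has \<open>g {x} \<le> 0\<close>, whence \<open>\<delta> (A \<union> {x}) \<le> g A + g {x} \<le> g A\<close>.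
\<close>

lemma kappa_in_tight_span:
  assumes x: "x \<in> X"
  shows "tight_span_kappa X \<delta> x \<in> tight_span X \<delta>"
  unfolding tight_span_def
proof (intro CollectI conjI ballI impI)
  show "tight_span_kappa X \<delta> x \<in> diversity_P X \<delta>"
    unfolding diversity_P_def
  proof (intro CollectI conjI allI impI)
    show "tight_span_kappa X \<delta> x \<in> extensional (Fpow X)"
      by (simp add: tight_span_kappa_def)
    show "tight_span_kappa X \<delta> x {} = 0"
      using x by (simp add: kappa_apply Fpow_def)
    fix \<A> assume \<A>: "finite \<A> \<and> \<A> \<subseteq> Fpow X"
    have "\<delta> (\<Union>\<A>) \<le> \<delta> ({x} \<union> (\<Union>A\<in>\<A>. A \<union> {x}))"
      using x \<A> by (intro mono) (auto simp: Fpow_def)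
    also have "\<dots> \<le> \<delta> {x} + (\<Sum>A\<in>\<A>. \<delta> (A \<union> {x}))"
      using x \<A> by (intro star_bound) (auto simp: Fpow_def)
    also have "\<dots> = (\<Sum>A\<in>\<A>. tight_span_kappa X \<delta> x A)"
      using x \<A> by (auto simp: kappa_apply intro!: sum.cong)
    finally show "\<delta> (\<Union>\<A>) \<le> (\<Sum>A\<in>\<A>. tight_span_kappa X \<delta> x A)" .
  qed
  fix g assume g: "g \<in> diversity_P X \<delta>"
    and le: "\<forall>A\<in>Fpow X. g A \<le> tight_span_kappa X \<delta> x A"
  have x': "{x} \<in> Fpow X" using x by (simp add: Fpow_def)
  have "g {x} \<le> 0" using le x x' by (force simp: kappa_apply)
  then have "tight_span_kappa X \<delta> x A \<le> g A" if "A \<in> Fpow X" for A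
    using P_union[OF g that x'] that by (simp add: kappa_apply)
  then show "g = tight_span_kappa X \<delta> x"
    using le g
    by (intro extensionalityI[of g "Fpow X"])
      (auto simp: diversity_P_def tight_span_kappa_def intro: antisym)
qed

text \<open>
  Let \<open>B g\<close> be the sets chosen for the members \<open>g\<close> of the set on the left. The set chosen for
  \<open>\<kappa> x\<close> is attached at the point \<open>x\<close> to the base \<open>A \<union> B f\<close>, at the cost that \<open>\<kappa> x\<close> assigns to
  it, and the base itself costs at most \<open>f A + f (B f)\<close>.
\<close>

lemma tight_span_diversity_insert_kappa_le:
  assumes f: "f \<in> tight_span X \<delta>" and A: "A \<in> Fpow X"
  shows "tight_span_diversity X \<delta> (insert f (tight_span_kappa X \<delta> ` A)) \<le> f A"
proof -
  define J where "J = tight_span_kappa X \<delta> ` A - {f}"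
  have J: "finite J" "f \<notin> J" "insert f (tight_span_kappa X \<delta> ` A) = insert f J"
    using A by (auto simp: J_def Fpow_def)
  have AX: "A \<subseteq> X" "finite A" using A by (auto simp: Fpow_def)
  have "\<forall>g\<in>J. \<exists>x. x \<in> A \<and> g = tight_span_kappa X \<delta> x" by (auto simp: J_def)
  then obtain x where x: "\<And>g. g \<in> J \<Longrightarrow> x g \<in> A"
    "\<And>g. g \<in> J \<Longrightarrow> g = tight_span_kappa X \<delta> (x g)"
    by metis
  have JT: "J \<subseteq> tight_span X \<delta>" using AX by (auto simp: J_def intro: kappa_in_tight_span)
  have "tight_span_diversity X \<delta> (insert f J) \<le> f A"
  proof (rule tight_span_diversity_leI)
    fix B assume "B \<in> insert f J \<rightarrow> Fpow X"
    then have B: "B f \<in> Fpow X" "\<And>g. g \<in> J \<Longrightarrow> B g \<in> Fpow X" by auto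
    have BX: "A \<union> B f \<in> Fpow X" "\<And>g. g \<in> J \<Longrightarrow> B g \<union> {x g} \<in> Fpow X"
      using A B x(1) AX by (auto simp: Fpow_def)
    have "\<delta> (\<Union>g\<in>insert f J. B g) \<le> \<delta> ((A \<union> B f) \<union> (\<Union>g\<in>J. B g \<union> {x g}))"
      using BX J(1) by (intro mono) (auto simp: Fpow_def)
    also have "\<dots> \<le> \<delta> (A \<union> B f) + (\<Sum>g\<in>J. \<delta> (B g \<union> {x g}))"
      using BX J(1) x(1) by (intro star_bound) auto
    also have "(\<Sum>g\<in>J. \<delta> (B g \<union> {x g})) = (\<Sum>g\<in>J. g (B g))"
      using B x(2) by (intro sum.cong refl) (metis kappa_apply)
    also have "\<delta> (A \<union> B f) \<le> f A + f (B f)"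
      using f A B by (intro P_union tight_span_P)
    finally show "\<delta> (\<Union>g\<in>insert f J. B g) \<le> f A + (\<Sum>g\<in>insert f J. g (B g))"
      using J by simp
  qed (use J JT f in auto)
  then show ?thesis by (simp add: J(3))
qed

lemma kappa_isometry:
  assumes A: "A \<in> Fpow X"
  shows "tight_span_diversity X \<delta> (tight_span_kappa X \<delta> ` A) = \<delta> A"
proof (cases "A = {}")
  case True
  then show ?thesis by (simp add: tight_span_diversity_def)
next
  case False
  then obtain a where a: "a \<in> A" by blast
  have AX: "A \<subseteq> X" "finite A" using A by (auto simp: Fpow_def)
  have "tight_span_diversity X \<delta> (insert (tight_span_kappa X \<delta> a) (tight_span_kappa X \<delta> ` A))
      \<le> tight_span_kappa X \<delta> a A"
    using a A AX by (intro tight_span_diversity_insert_kappa_le kappa_in_tight_span) auto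
  then have "tight_span_diversity X \<delta> (tight_span_kappa X \<delta> ` A) \<le> \<delta> A"
    using a A by (simp add: insert_absorb kappa_apply)
  moreover have "\<delta> (\<Union>x\<in>A. {x}) \<le> tight_span_diversity X \<delta> (tight_span_kappa X \<delta> ` A)
      + (\<Sum>x\<in>A. tight_span_kappa X \<delta> x {x})"
    using False AX
    by (intro tight_span_diversity_ge) (auto simp: Fpow_def intro: kappa_in_tight_span)
  moreover have "(\<Sum>x\<in>A. tight_span_kappa X \<delta> x {x}) = 0"
    using AX by (intro sum.neutral) (auto simp: kappa_apply Fpow_def)
  ultimately show ?thesis by simp
qed

text \<open>Isometries are injective, since two distinct points have positive diversity.\<close>

lemma embeddingI:
  assumes Z: "diversity Z \<delta>Z" and \<phi>: "\<phi> \<in> X \<rightarrow> Z"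
    and iso: "\<And>A. A \<in> Fpow X \<Longrightarrow> \<delta> A = \<delta>Z (\<phi> ` A)"
  shows "diversity_embedding X \<delta> Z \<delta>Z \<phi>"
  unfolding diversity_embedding_def
proof (intro conjI ballI inj_onI)
  fix x y assume xy: "x \<in> X" "y \<in> X" "\<phi> x = \<phi> y"
  have "\<delta> {x, y} = \<delta>Z {\<phi> x}" using iso[of "{x, y}"] xy by (simp add: Fpow_def)
  also have "\<dots> = 0" using diversity.singleton[OF Z] \<phi> xy by blast
  finally show "x = y" using xy by (intro eq_of_pair_zero) auto
qed (use \<phi> iso in auto)

lemma kappa_embedding:
  "diversity_embedding X \<delta> (tight_span X \<delta>) (tight_span_diversity X \<delta>) (tight_span_kappa X \<delta>)"
  using tight_span_is_diversity by (rule embeddingI) (auto simp: kappa_in_tight_span kappa_isometry)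

end


section \<open>Hyperconvex diversities are injective\<close>

text \<open>
  Partial non-expansive maps are represented by their graphs. The condition speaks of finite
  subsets only, so it passes to unions of chains.
\<close>

definition nonexpansive_graph ::
  "'a set \<Rightarrow> ('a set \<Rightarrow> real) \<Rightarrow> 'b set \<Rightarrow> ('b set \<Rightarrow> real) \<Rightarrow> ('a \<times> 'b) set \<Rightarrow> bool" where
  "nonexpansive_graph Z \<delta>Z Y \<delta>Y G \<longleftrightarrow>
     G \<subseteq> Z \<times> Y \<and> (\<forall>H\<in>Fpow G. \<delta>Y (snd ` H) \<le> \<delta>Z (fst ` H))"

text \<open>
  A non-expansive graph is automatically a partial function: two values of one point would be
  distinct points at diversity at most \<open>\<delta>Z {z} = 0\<close>.
\<close>

lemma nonexpansive_graph_single_valued: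
  assumes Z: "diversity Z \<delta>Z" and Y: "diversity Y \<delta>Y"
    and G: "nonexpansive_graph Z \<delta>Z Y \<delta>Y G" and z: "(z, y) \<in> G" "(z, y') \<in> G"
  shows "y = y'"
proof -
  have mem: "z \<in> Z" "y \<in> Y" "y' \<in> Y" using G z by (auto simp: nonexpansive_graph_def)
  have "{(z, y), (z, y')} \<in> Fpow G" using z by (simp add: Fpow_def)
  then have "\<delta>Y (snd ` {(z, y), (z, y')}) \<le> \<delta>Z (fst ` {(z, y), (z, y')})"
    using G unfolding nonexpansive_graph_def by blast
  then have "\<delta>Y {y, y'} \<le> 0" using mem diversity.singleton[OF Z] by simp
  then show ?thesis using mem by (intro diversity.eq_of_pair_zero[OF Y]) auto
qed

lemma le_sum_INF:
  fixes g :: "'i \<Rightarrow> 'p \<Rightarrow> real"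
  assumes "finite I" and S: "\<And>i. i \<in> I \<Longrightarrow> S i \<noteq> {}"
    and le: "\<And>p. (\<And>i. i \<in> I \<Longrightarrow> p i \<in> S i) \<Longrightarrow> c \<le> (\<Sum>i\<in>I. g i (p i))"
    and bdd: "\<And>i. i \<in> I \<Longrightarrow> bdd_below (g i ` S i)"
  shows "c \<le> (\<Sum>i\<in>I. INF q\<in>S i. g i q)"
proof (rule field_le_epsilon)
  fix e :: real assume "e > 0"
  define e' where "e' = e / (card I + 1)"
  have e': "e' > 0" using \<open>e > 0\<close> by (simp add: e'_def)
  have "\<forall>i\<in>I. \<exists>q\<in>S i. g i q < (INF q\<in>S i. g i q) + e'"
    using cINF_less_iff[OF S bdd] e' by (metis less_add_same_cancel1)
  then obtain p where p: "\<And>i. i \<in> I \<Longrightarrow> p i \<in> S i"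
    "\<And>i. i \<in> I \<Longrightarrow> g i (p i) < (INF q\<in>S i. g i q) + e'"
    by metis
  have "c \<le> (\<Sum>i\<in>I. g i (p i))" by (rule le) (rule p(1))
  also have "\<dots> \<le> (\<Sum>i\<in>I. (INF q\<in>S i. g i q) + e')"
    using p(2) by (intro sum_mono) (simp add: less_imp_le)
  also have "\<dots> = (\<Sum>i\<in>I. INF q\<in>S i. g i q) + card I * e'"
    by (simp add: sum.distrib)
  also have "card I * e' \<le> e"
    using \<open>e > 0\<close> by (simp add: e'_def field_simps)
  finally show "c \<le> (\<Sum>i\<in>I. INF q\<in>S i. g i q) + e" by simp
qed

lemma hyperconvexE:
  assumes "hyperconvex_diversity Y \<delta>Y"
    and "\<And>\<A>. finite \<A> \<Longrightarrow> \<A> \<subseteq> Fpow Y \<Longrightarrow> \<delta>Y (\<Union>\<A>) \<le> sum r \<A>"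
  obtains z where "z \<in> Y" "\<And>B. B \<in> Fpow Y \<Longrightarrow> \<delta>Y ({z} \<union> B) \<le> r B"
  using assms(1)[unfolded hyperconvex_diversity_def, rule_format, of r] assms(2) by blast

lemma hyperconvex_nonempty:
  assumes Y: "diversity Y \<delta>Y" and hc: "hyperconvex_diversity Y \<delta>Y"
  shows "Y \<noteq> {}"
proof
  assume "Y = {}"
  have "\<delta>Y (\<Union>\<A>) \<le> sum (\<lambda>_. 0) \<A>" if "\<A> \<subseteq> Fpow Y" for \<A>
  proof -
    have "\<Union>\<A> = {}" using that \<open>Y = {}\<close> by (auto simp: Fpow_def)
    then have "\<delta>Y (\<Union>\<A>) = 0" using diversity.empty[OF Y] by metis
    then show ?thesis by simp
  qed
  then obtain z where "z \<in> Y" using hyperconvexE[OF hc] by blast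
  then show False using \<open>Y = {}\<close> by simp
qed

text \<open>
  The image of the new point \<open>z\<close> comes from hyperconvexity. The bound \<open>r B\<close> has to be real for
  every finite \<open>B \<subseteq> Y\<close>, also where \<open>B\<close> is not in the range of the graph. So \<open>B\<close> is covered by a
  part \<open>snd ` H\<close> of the range, which costs \<open>\<delta>Z (insert z (fst ` H))\<close>, and by a set \<open>C\<close> that
  meets this part and costs \<open>\<delta>Y C\<close>; \<open>r B\<close> is the infimum of the total cost. For \<open>B = snd ` H\<close> a
  singleton \<open>C\<close> adds nothing, which gives the required bound.
\<close>

lemma nonexpansive_graph_extend_point:
  assumes Z: "diversity Z \<delta>Z" and Y: "diversity Y \<delta>Y" and hc: "hyperconvex_diversity Y \<delta>Y"
    and G: "nonexpansive_graph Z \<delta>Z Y \<delta>Y G" and z: "z \<in> Z"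
  shows "\<exists>y\<in>Y. nonexpansive_graph Z \<delta>Z Y \<delta>Y (insert (z, y) G)"
proof -
  interpret Z: diversity Z \<delta>Z by (rule Z)
  interpret Y: diversity Y \<delta>Y by (rule Y)
  have GZY: "G \<subseteq> Z \<times> Y" and Gle: "\<And>H. H \<in> Fpow G \<Longrightarrow> \<delta>Y (snd ` H) \<le> \<delta>Z (fst ` H)"
    using G by (auto simp: nonexpansive_graph_def)
  have fstZ: "fst ` H \<in> Fpow Z" and sndY: "snd ` H \<in> Fpow Y" if "H \<in> Fpow G" for H
    using that GZY by (auto simp: Fpow_def)
  have "\<exists>y\<in>Y. \<forall>H\<in>Fpow G. \<delta>Y (insert y (snd ` H)) \<le> \<delta>Z (insert z (fst ` H))"
  proof (cases "G = {}")
    case True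
    then show ?thesis
      using hyperconvex_nonempty[OF Y hc] z by (auto simp: Fpow_def)
  next
    case False
    define S where "S B = {(H, C). H \<in> Fpow G \<and> C \<in> Fpow Y \<and> C \<inter> snd ` H \<noteq> {} \<and> B \<subseteq> snd ` H \<union> C}"
      for B
    define cost where "cost = (\<lambda>(H :: ('a \<times> 'b) set, C). \<delta>Z (insert z (fst ` H)) + \<delta>Y C)"
    define r where "r B = (INF q\<in>S B. cost q)" for B
    have ins: "insert z (fst ` H) \<in> Fpow Z" if "H \<in> Fpow G" for H
      using fstZ[OF that] z by (simp add: Fpow_def)
    have cost_nonneg: "0 \<le> cost q" if "q \<in> S B" for q B
      using that Z.nonneg[OF ins] Y.nonneg by (auto simp: S_def cost_def intro: add_nonneg_nonneg)
    then have bdd: "bdd_below (cost ` S B)" for B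
      by (auto intro: bdd_belowI2[where m = 0])
    have ne: "S B \<noteq> {}" if "B \<in> Fpow Y" for B
    proof -
      obtain p where p: "p \<in> G" using False by blast
      then have "({p}, insert (snd p) B) \<in> S B"
        using that GZY by (auto simp: S_def Fpow_def)
      then show ?thesis by blast
    qed
    have "\<delta>Y (\<Union>\<B>) \<le> sum r \<B>" if \<B>: "finite \<B>" "\<B> \<subseteq> Fpow Y" for \<B>
      unfolding r_def
    proof (rule le_sum_INF)
      fix p assume p: "\<And>B. B \<in> \<B> \<Longrightarrow> p B \<in> S B"
      define H C where "H B = fst (p B)" and "C B = snd (p B)" for B
      have H: "H B \<in> Fpow G" and C: "C B \<in> Fpow Y"
        and meet: "C B \<inter> snd ` H B \<noteq> {}" and cover: "B \<subseteq> snd ` H B \<union> C B"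
        if "B \<in> \<B>" for B
        using p[OF that] by (simp_all add: S_def H_def C_def case_prod_beta)
      have UH: "(\<Union>B\<in>\<B>. H B) \<in> Fpow G" using H \<B> by (auto simp: Fpow_def)
      have UZ: "{z} \<union> (\<Union>B\<in>\<B>. insert z (fst ` H B)) \<in> Fpow Z"
        using ins[OF H] \<B> z by (auto simp: Fpow_def)
      have UY: "snd ` (\<Union>B\<in>\<B>. H B) \<union> (\<Union>B\<in>\<B>. C B) \<in> Fpow Y"
        using sndY[OF UH] C \<B> by (auto simp: Fpow_def)
      have "\<Union>\<B> \<subseteq> snd ` (\<Union>B\<in>\<B>. H B) \<union> (\<Union>B\<in>\<B>. C B)"
        using cover by fastforce
      then have "\<delta>Y (\<Union>\<B>) \<le> \<delta>Y (snd ` (\<Union>B\<in>\<B>. H B) \<union> (\<Union>B\<in>\<B>. C B))"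
        using UY by (rule Y.mono)
      also have "\<dots> \<le> \<delta>Y (snd ` (\<Union>B\<in>\<B>. H B)) + (\<Sum>B\<in>\<B>. \<delta>Y (C B))"
        using \<B> sndY[OF UH] C
      proof (intro Y.star_bound)
        fix B assume "B \<in> \<B>"
        then show "C B \<inter> snd ` (\<Union>B\<in>\<B>. H B) \<noteq> {}" using meet[of B] by blast
      qed auto
      also have "\<delta>Y (snd ` (\<Union>B\<in>\<B>. H B)) \<le> \<delta>Z (fst ` (\<Union>B\<in>\<B>. H B))"
        by (rule Gle[OF UH])
      also have "\<dots> \<le> \<delta>Z ({z} \<union> (\<Union>B\<in>\<B>. insert z (fst ` H B)))"
        using UZ by (intro Z.mono) auto
      also have "\<dots> \<le> \<delta>Z {z} + (\<Sum>B\<in>\<B>. \<delta>Z (insert z (fst ` H B)))"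
        using \<B> ins[OF H] z by (intro Z.star_bound) (auto simp: Fpow_def)
      finally show "\<delta>Y (\<Union>\<B>) \<le> (\<Sum>B\<in>\<B>. cost (p B))"
        using z by (simp add: cost_def H_def C_def sum.distrib case_prod_beta)
    qed (use \<B> ne bdd in auto)
    then obtain y where y: "y \<in> Y" "\<And>B. B \<in> Fpow Y \<Longrightarrow> \<delta>Y ({y} \<union> B) \<le> r B"
      using hyperconvexE[OF hc] by blast
    have "\<delta>Y (insert y (snd ` H)) \<le> \<delta>Z (insert z (fst ` H))" if H: "H \<in> Fpow G" for H
    proof (cases "H = {}")
      case True
      then show ?thesis using y z by simp
    next
      case False
      then obtain p where p: "p \<in> H" by blast
      have pY: "snd p \<in> Y" using p H GZY by (auto simp: Fpow_def)
      have "(H, {snd p}) \<in> S (snd ` H)" using H p pY by (auto simp: S_def Fpow_def)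
      then have "r (snd ` H) \<le> cost (H, {snd p})"
        unfolding r_def by (intro cINF_lower bdd)
      also have "\<dots> = \<delta>Z (insert z (fst ` H))" using pY by (simp add: cost_def)
      finally show ?thesis using y(2)[OF sndY[OF H]] by simp
    qed
    then show ?thesis using y(1) by blast
  qed
  then obtain y where y: "y \<in> Y"
    "\<And>H. H \<in> Fpow G \<Longrightarrow> \<delta>Y (insert y (snd ` H)) \<le> \<delta>Z (insert z (fst ` H))"
    by blast
  have "\<delta>Y (snd ` H) \<le> \<delta>Z (fst ` H)" if "H \<in> Fpow (insert (z, y) G)" for H
  proof (cases "(z, y) \<in> H")
    case True
    then obtain H' where H': "H = insert (z, y) H'" "(z, y) \<notin> H'"
      by (meson mk_disjoint_insert)
    have "H' \<in> Fpow G" using that H' by (auto simp: Fpow_def)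
    from y(2)[OF this] show ?thesis by (simp add: H'(1))
  next
    case False
    then have "H \<in> Fpow G" using that by (auto simp: Fpow_def)
    then show ?thesis by (rule Gle)
  qed
  then have "nonexpansive_graph Z \<delta>Z Y \<delta>Y (insert (z, y) G)"
    using GZY z y(1) by (auto simp: nonexpansive_graph_def)
  then show ?thesis using y(1) by blast
qed

lemma nonexpansive_graph_Union_chain:
  assumes chain: "subset.chain {G. nonexpansive_graph Z \<delta>Z Y \<delta>Y G} \<C>" and ne: "\<C> \<noteq> {}"
  shows "nonexpansive_graph Z \<delta>Z Y \<delta>Y (\<Union>\<C>)"
  unfolding nonexpansive_graph_def
proof (intro conjI ballI)
  have \<C>: "nonexpansive_graph Z \<delta>Z Y \<delta>Y G" if "G \<in> \<C>" for G
    using chain that by (auto simp: subset.chain_def)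
  then show "\<Union>\<C> \<subseteq> Z \<times> Y" unfolding nonexpansive_graph_def by blast
  fix H assume "H \<in> Fpow (\<Union>\<C>)"
  then have "finite H" "H \<subseteq> \<Union>\<C>" by (auto simp: Fpow_def)
  then obtain G where "G \<in> \<C>" "H \<subseteq> G"
    using finite_subset_Union_chain[OF _ _ ne chain] by metis
  then show "\<delta>Y (snd ` H) \<le> \<delta>Z (fst ` H)"
    using \<C> \<open>finite H\<close> by (simp add: nonexpansive_graph_def Fpow_def)
qed

text \<open>
  By Zorn's lemma the graph of the given map lies in a maximal non-expansive graph, and the
  one-point extension makes this graph total.
\<close>

lemma hyperconvex_imp_injective:
  assumes Y: "diversity Y \<delta>Y" and hc: "hyperconvex_diversity Y \<delta>Y"
  shows "injective_diversity TYPE('b) TYPE('c) Y \<delta>Y"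
  unfolding injective_diversity_def
proof (intro allI impI)
  fix W :: "'b set" and \<delta>W and Z :: "'c set" and \<delta>Z \<iota> \<phi>
  assume Z: "diversity Z \<delta>Z" and \<iota>: "diversity_embedding W \<delta>W Z \<delta>Z \<iota>"
    and \<phi>: "nonexpansive W \<delta>W Y \<delta>Y \<phi>"
  define G0 where "G0 = (\<lambda>w. (\<iota> w, \<phi> w)) ` W"
  define \<G> where "\<G> = {G. nonexpansive_graph Z \<delta>Z Y \<delta>Y G \<and> G0 \<subseteq> G}"
  have "nonexpansive_graph Z \<delta>Z Y \<delta>Y G0"
    unfolding nonexpansive_graph_def
  proof (intro conjI ballI)
    show "G0 \<subseteq> Z \<times> Y"
      using \<iota> \<phi> by (auto simp: G0_def diversity_embedding_def nonexpansive_def)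
    fix H assume "H \<in> Fpow G0"
    then obtain A where A: "A \<subseteq> W" "finite A" "H = (\<lambda>w. (\<iota> w, \<phi> w)) ` A"
      unfolding G0_def Fpow_def using finite_subset_image
      by (metis (no_types, lifting) mem_Collect_eq)
    then have "A \<in> Fpow W" by (simp add: Fpow_def)
    then have "\<delta>Y (\<phi> ` A) \<le> \<delta>Z (\<iota> ` A)"
      using \<iota> \<phi> by (simp add: diversity_embedding_def nonexpansive_def)
    then show "\<delta>Y (snd ` H) \<le> \<delta>Z (fst ` H)" by (simp add: A(3) image_image)
  qed
  then have "G0 \<in> \<G>" by (simp add: \<G>_def)
  have "\<exists>M\<in>\<G>. \<forall>G\<in>\<G>. M \<subseteq> G \<longrightarrow> G = M"
  proof (rule subset_Zorn_nonempty)
    show "\<G> \<noteq> {}" using \<open>G0 \<in> \<G>\<close> by blast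
    fix \<C> assume \<C>: "\<C> \<noteq> {}" "subset.chain \<G> \<C>"
    then have "subset.chain {G. nonexpansive_graph Z \<delta>Z Y \<delta>Y G} \<C>"
      by (auto simp: subset.chain_def \<G>_def)
    then have "nonexpansive_graph Z \<delta>Z Y \<delta>Y (\<Union>\<C>)"
      using \<C>(1) by (rule nonexpansive_graph_Union_chain)
    moreover have "G0 \<subseteq> \<Union>\<C>" using \<C> unfolding subset.chain_def \<G>_def by blast
    ultimately show "\<Union>\<C> \<in> \<G>" by (simp add: \<G>_def)
  qed
  then obtain M where "M \<in> \<G>" and max: "\<And>G. G \<in> \<G> \<Longrightarrow> M \<subseteq> G \<Longrightarrow> G = M" by blast
  then have M: "nonexpansive_graph Z \<delta>Z Y \<delta>Y M" "G0 \<subseteq> M" by (auto simp: \<G>_def)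
  have "\<exists>y. (z, y) \<in> M" if z: "z \<in> Z" for z
  proof -
    obtain y where "nonexpansive_graph Z \<delta>Z Y \<delta>Y (insert (z, y) M)"
      using nonexpansive_graph_extend_point[OF Z Y hc M(1) z] by blast
    then have "insert (z, y) M = M" using M(2) by (intro max) (auto simp: \<G>_def)
    then show ?thesis by blast
  qed
  then obtain \<psi> where \<psi>: "\<And>z. z \<in> Z \<Longrightarrow> (z, \<psi> z) \<in> M" by metis
  have "nonexpansive Z \<delta>Z Y \<delta>Y \<psi>"
    unfolding nonexpansive_def
  proof (intro conjI ballI)
    show "\<psi> \<in> Z \<rightarrow> Y" using \<psi> M(1) by (auto simp: nonexpansive_graph_def)
    fix A assume "A \<in> Fpow Z"
    then have "(\<lambda>z. (z, \<psi> z)) ` A \<in> Fpow M" using \<psi> by (auto simp: Fpow_def)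
    then have "\<delta>Y (snd ` (\<lambda>z. (z, \<psi> z)) ` A) \<le> \<delta>Z (fst ` (\<lambda>z. (z, \<psi> z)) ` A)"
      using M(1) unfolding nonexpansive_graph_def by blast
    then show "\<delta>Y (\<psi> ` A) \<le> \<delta>Z A" by (simp add: image_image)
  qed
  moreover have "\<phi> w = (\<psi> \<circ> \<iota>) w" if w: "w \<in> W" for w
  proof -
    have "\<iota> w \<in> Z" using \<iota> w by (auto simp: diversity_embedding_def)
    moreover have "(\<iota> w, \<phi> w) \<in> M" using w M(2) by (auto simp: G0_def)
    ultimately show ?thesis
      using nonexpansive_graph_single_valued[OF Z Y M(1)] \<psi> by (metis comp_apply)
  qed
  ultimately show "\<exists>\<psi>. nonexpansive Z \<delta>Z Y \<delta>Y \<psi> \<and> (\<forall>w\<in>W. \<phi> w = (\<psi> \<circ> \<iota>) w)" by blast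
qed


section \<open>Tightness of the canonical embedding\<close>

text \<open>
  Choose sets \<open>A f\<close> for \<open>f \<in> F\<close>. In \<open>Y\<close> the set \<open>\<pi> ` A f \<union> {\<psi> f}\<close> meets the base \<open>\<psi> ` F\<close>, and
  its diversity is at most \<open>f (A f)\<close>, because \<open>\<psi>\<close> does not expand \<open>\<kappa> ` A f \<union> {f}\<close>. The star
  bound in \<open>Y\<close> therefore gives \<open>\<delta> (\<Union>f\<in>F. A f) \<le> \<delta>Y (\<psi> ` F) + (\<Sum>f\<in>F. f (A f))\<close>, which says that
  \<open>\<psi>\<close> does not contract \<open>F\<close>.
\<close>

lemma (in diversity) nonexpansive_extension_is_embedding:
  assumes Y: "diversity Y \<delta>Y" and \<pi>: "diversity_embedding X \<delta> Y \<delta>Y \<pi>"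
    and \<psi>: "nonexpansive (tight_span X \<delta>) (tight_span_diversity X \<delta>) Y \<delta>Y \<psi>"
    and ext: "\<And>x. x \<in> X \<Longrightarrow> \<psi> (tight_span_kappa X \<delta> x) = \<pi> x"
  shows "diversity_embedding (tight_span X \<delta>) (tight_span_diversity X \<delta>) Y \<delta>Y \<psi>"
proof (rule diversity.embeddingI[OF tight_span_is_diversity Y])
  interpret Y: diversity Y \<delta>Y by (rule Y)
  show \<psi>Y: "\<psi> \<in> tight_span X \<delta> \<rightarrow> Y" using \<psi> by (simp add: nonexpansive_def)
  have le: "\<delta>Y (\<psi> ` F) \<le> tight_span_diversity X \<delta> F" if "F \<in> Fpow (tight_span X \<delta>)" for F
    using \<psi> that by (simp add: nonexpansive_def)
  have \<pi>Y: "\<pi> \<in> X \<rightarrow> Y" and iso: "\<And>A. A \<in> Fpow X \<Longrightarrow> \<delta> A = \<delta>Y (\<pi> ` A)"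
    using \<pi> by (auto simp: diversity_embedding_def)
  have point: "\<delta>Y (insert (\<psi> f) (\<pi> ` A)) \<le> f A"
    if f: "f \<in> tight_span X \<delta>" and A: "A \<in> Fpow X" for f A
  proof -
    have "\<psi> ` tight_span_kappa X \<delta> ` A = \<pi> ` A"
      using A ext by (force simp: image_image Fpow_def)
    then have "\<delta>Y (insert (\<psi> f) (\<pi> ` A)) = \<delta>Y (\<psi> ` insert f (tight_span_kappa X \<delta> ` A))"
      by simp
    also have "\<dots> \<le> tight_span_diversity X \<delta> (insert f (tight_span_kappa X \<delta> ` A))"
      using f A by (intro le) (auto simp: Fpow_def intro: kappa_in_tight_span)
    also have "\<dots> \<le> f A" by (rule tight_span_diversity_insert_kappa_le[OF f A])
    finally show ?thesis .
  qed
  fix F assume F: "F \<in> Fpow (tight_span X \<delta>)"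
  then have fin: "finite F" and sub: "F \<subseteq> tight_span X \<delta>" by (auto simp: Fpow_def)
  show "tight_span_diversity X \<delta> F = \<delta>Y (\<psi> ` F)"
  proof (cases "F = {}")
    case True
    then show ?thesis by (simp add: tight_span_diversity_def)
  next
    case False
    have "tight_span_diversity X \<delta> F \<le> \<delta>Y (\<psi> ` F)"
    proof (rule tight_span_diversity_leI[OF fin False sub])
      fix A assume "A \<in> F \<rightarrow> Fpow X"
      then have A: "A f \<in> Fpow X" if "f \<in> F" for f using that by blast
      have base: "\<psi> ` F \<in> Fpow Y" and arms: "\<And>f. f \<in> F \<Longrightarrow> insert (\<psi> f) (\<pi> ` A f) \<in> Fpow Y"
        using fin sub A \<psi>Y \<pi>Y by (auto simp: Fpow_def) blast+
      have "\<delta> (\<Union>f\<in>F. A f) = \<delta>Y (\<pi> ` (\<Union>f\<in>F. A f))"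
        using A fin by (intro iso) (auto simp: Fpow_def)
      also have "\<dots> \<le> \<delta>Y (\<psi> ` F \<union> (\<Union>f\<in>F. insert (\<psi> f) (\<pi> ` A f)))"
        using base arms fin by (intro Y.mono) (auto simp: Fpow_def)
      also have "\<dots> \<le> \<delta>Y (\<psi> ` F) + (\<Sum>f\<in>F. \<delta>Y (insert (\<psi> f) (\<pi> ` A f)))"
        using base arms fin by (intro Y.star_bound) auto
      also have "\<dots> \<le> \<delta>Y (\<psi> ` F) + (\<Sum>f\<in>F. f (A f))"
        using A sub by (intro add_left_mono sum_mono point) auto
      finally show "\<delta> (\<Union>f\<in>F. A f) \<le> \<delta>Y (\<psi> ` F) + (\<Sum>f\<in>F. f (A f))" .
    qed
    then show ?thesis using le[OF F] by simp
  qed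
qed

theorem theorem3p8:
  fixes X :: "'a set" and \<delta> :: "'a set \<Rightarrow> real"
    and Y :: "'b set" and \<delta>Y :: "'b set \<Rightarrow> real"
    and \<pi> :: "'a \<Rightarrow> 'b"
  assumes "diversity X \<delta>"
    and "diversity Y \<delta>Y"
    and "diversity_embedding X \<delta> Y \<delta>Y \<pi>"
    and "injective_diversity TYPE('a) TYPE('a set \<Rightarrow> real) Y \<delta>Y \<or> hyperconvex_diversity Y \<delta>Y"
  shows "\<exists>\<phi>. diversity_embedding (tight_span X \<delta>) (tight_span_diversity X \<delta>) Y \<delta>Y \<phi> \<and>
             (\<forall>x\<in>X. \<pi> x = (\<phi> \<circ> tight_span_kappa X \<delta>) x)"
proof -
  interpret diversity X \<delta> by (rule assms(1))
  have "injective_diversity TYPE('a) TYPE('a set \<Rightarrow> real) Y \<delta>Y"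
    using assms(2,4) hyperconvex_imp_injective by blast
  moreover have "nonexpansive X \<delta> Y \<delta>Y \<pi>"
    using assms(3) by (simp add: diversity_embedding_def nonexpansive_def)
  ultimately obtain \<psi>
    where \<psi>: "nonexpansive (tight_span X \<delta>) (tight_span_diversity X \<delta>) Y \<delta>Y \<psi>"
      "\<forall>x\<in>X. \<pi> x = (\<psi> \<circ> tight_span_kappa X \<delta>) x"
    using assms(1) tight_span_is_diversity kappa_embedding
    unfolding injective_diversity_def by blast
  then have "diversity_embedding (tight_span X \<delta>) (tight_span_diversity X \<delta>) Y \<delta>Y \<psi>"
    using assms(2,3) by (intro nonexpansive_extension_is_embedding[where \<pi> = \<pi>]) auto
  then show ?thesis using \<psi>(2) by blast
qed

end
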